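(* Weighted dual skeletons, with morphisms of skeletons as arrows, form a category, in which composition is composition of maps and the identity on $\mathcal E=(Z,\sigma,\kappa)$ is the identity map $\mathrm{id}_Z$.
   Context: A weighted dual skeleton is a triple $\mathcal E=(Z,\sigma,\kappa)$ where $Z$ is a non-empty finite set, $\sigma:Z\to Z$ satisfies $\sigma^2=\mathrm{id}$, and $\kappa:Z\to\mathbb R_{>0}$ satisfies $\kappa(z)\kappa(\sigma(z))=K$ for all $z\in Z$, with $K>0$ constant. A morphism of skeletons $\phi:(Z_1,\sigma_1,\kappa_1)\to(Z_2,\sigma_2,\kappa_2)$ is a map $\phi:Z_1\to Z_2$ with $\phi(\sigma_1(z))=\sigma_2(\phi(z))$ and $\kappa_1(z)=\kappa_2(\phi(z))$ for all $z\in Z_1$. *)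

theory Defs
  imports Complex_Main "HOL-Library.FuncSet"
begin

text \<open>
  A (one-collection-of-arrows) category: every arrow determines its source and its target, and
  \<open>comp g f\<close> (``\<open>g\<close> after \<open>f\<close>'') is only constrained when \<open>tgt f = src g\<close>.
\<close>

locale category =
  fixes Obj :: "'o set"
    and Arr :: "'m set"
    and src :: "'m \<Rightarrow> 'o"
    and tgt :: "'m \<Rightarrow> 'o"
    and ident :: "'o \<Rightarrow> 'm"
    and comp :: "'m \<Rightarrow> 'm \<Rightarrow> 'm"
  assumes src_Obj: "f \<in> Arr \<Longrightarrow> src f \<in> Obj"
    and tgt_Obj: "f \<in> Arr \<Longrightarrow> tgt f \<in> Obj"
    and ident_Arr: "A \<in> Obj \<Longrightarrow> ident A \<in> Arr"
    and src_ident: "A \<in> Obj \<Longrightarrow> src (ident A) = A"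
    and tgt_ident: "A \<in> Obj \<Longrightarrow> tgt (ident A) = A"
    and comp_Arr: "\<lbrakk>f \<in> Arr; g \<in> Arr; tgt f = src g\<rbrakk> \<Longrightarrow> comp g f \<in> Arr"
    and src_comp: "\<lbrakk>f \<in> Arr; g \<in> Arr; tgt f = src g\<rbrakk> \<Longrightarrow> src (comp g f) = src f"
    and tgt_comp: "\<lbrakk>f \<in> Arr; g \<in> Arr; tgt f = src g\<rbrakk> \<Longrightarrow> tgt (comp g f) = tgt g"
    and comp_assoc: "\<lbrakk>f \<in> Arr; g \<in> Arr; h \<in> Arr; tgt f = src g; tgt g = src h\<rbrakk>
      \<Longrightarrow> comp h (comp g f) = comp (comp h g) f"
    and comp_ident_right: "f \<in> Arr \<Longrightarrow> comp f (ident (src f)) = f"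
    and comp_ident_left: "f \<in> Arr \<Longrightarrow> comp (ident (tgt f)) f = f"

record 'a skeleton =
  points :: "'a set"
  dual :: "'a \<Rightarrow> 'a"
  weight :: "'a \<Rightarrow> real"

text \<open>
  A map on a set \<open>Z\<close> is represented by the HOL function that is \<open>undefined\<close> outside \<open>Z\<close>
  (\<open>\<rightarrow>\<^sub>E\<close>), so that HOL equality of skeletons and of morphisms is equality of the
  underlying triples and maps.
\<close>

definition weighted_dual_skeleton :: "'a skeleton \<Rightarrow> bool" where
  "weighted_dual_skeleton E \<longleftrightarrow>
     points E \<noteq> {} \<and> finite (points E) \<and>
     dual E \<in> points E \<rightarrow>\<^sub>E points E \<and>
     (\<forall>z\<in>points E. dual E (dual E z) = z) \<and>
     weight E \<in> points E \<rightarrow>\<^sub>E {0<..} \<and>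
     (\<exists>K>0. \<forall>z\<in>points E. weight E z * weight E (dual E z) = K)"

definition skeleton_morphism :: "'a skeleton \<Rightarrow> 'b skeleton \<Rightarrow> ('a \<Rightarrow> 'b) \<Rightarrow> bool" where
  "skeleton_morphism E1 E2 \<phi> \<longleftrightarrow>
     \<phi> \<in> points E1 \<rightarrow>\<^sub>E points E2 \<and>
     (\<forall>z\<in>points E1. \<phi> (dual E1 z) = dual E2 (\<phi> z)) \<and>
     (\<forall>z\<in>points E1. weight E1 z = weight E2 (\<phi> z))"

text \<open>
  The same map can be a morphism between different pairs of skeletons, so an arrow
  carries its source and target.
\<close>

record 'a skeleton_arrow =
  arrow_src :: "'a skeleton"
  arrow_tgt :: "'a skeleton"
  arrow_map :: "'a \<Rightarrow> 'a"

definition skeletons :: "'a skeleton set" where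
  "skeletons = {E. weighted_dual_skeleton E}"

definition skeleton_arrows :: "'a skeleton_arrow set" where
  "skeleton_arrows =
     {f. arrow_src f \<in> skeletons \<and> arrow_tgt f \<in> skeletons \<and>
         skeleton_morphism (arrow_src f) (arrow_tgt f) (arrow_map f)}"

definition skeleton_id :: "'a skeleton \<Rightarrow> 'a skeleton_arrow" where
  "skeleton_id E =
     \<lparr>arrow_src = E, arrow_tgt = E, arrow_map = restrict id (points E)\<rparr>"

definition skeleton_comp :: "'a skeleton_arrow \<Rightarrow> 'a skeleton_arrow \<Rightarrow> 'a skeleton_arrow" where
  "skeleton_comp g f =
     \<lparr>arrow_src = arrow_src f, arrow_tgt = arrow_tgt g,
      arrow_map = compose (points (arrow_src f)) (arrow_map g) (arrow_map f)\<rparr>"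

end

theory Submission
  imports Defs
begin

text \<open>
  Everything reduces to the two closure properties of morphisms. The involution and the weight
  condition are equations between maps, so they survive pasting two commuting squares (or
  triangles) and hold for the identity; the category laws are then those of functions
  between sets. The only care needed is that a map is an extensional function: composites and
  identities are truncated to the points of the source, and the laws hold on the nose because
  the truncated functions agree on the source and are both \<open>undefined\<close> elsewhere.
  The closure properties are \<open>skeleton_morphism_id\<close> and \<open>skeleton_morphism_compose\<close>.
\<close>

text \<open>
  A truncated map, whether the identity or a composite, is evaluated not only at \<open>z\<close> but also
  at the dual of \<open>z\<close>: its values there are the intended ones because the involution preserves
  the set of points.
\<close>

lemma skeleton_morphism_id:
  assumes "dual E \<in> points E \<rightarrow> points E"
  shows "skeleton_morphism E E (restrict id (points E))"
  using assms by (auto simp: skeleton_morphism_def)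

lemma skeleton_morphism_compose:
  assumes "dual E1 \<in> points E1 \<rightarrow> points E1"
    and "skeleton_morphism E1 E2 \<phi>" and "skeleton_morphism E2 E3 \<psi>"
  shows "skeleton_morphism E1 E3 (compose (points E1) \<psi> \<phi>)"
  using assms unfolding skeleton_morphism_def
  by (auto simp: compose_eq PiE_iff Pi_iff)

lemma dual_in_points:
  assumes "E \<in> skeletons"
  shows "dual E \<in> points E \<rightarrow> points E"
  using assms by (auto simp: skeletons_def weighted_dual_skeleton_def)

lemma skeleton_arrow_map:
  assumes "f \<in> skeleton_arrows"
  shows "arrow_map f \<in> points (arrow_src f) \<rightarrow> points (arrow_tgt f)"
    and "arrow_map f \<in> extensional (points (arrow_src f))"
  using assms by (auto simp: skeleton_arrows_def skeleton_morphism_def PiE_def)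

lemma skeletons_category:
  "category skeletons skeleton_arrows arrow_src arrow_tgt skeleton_id skeleton_comp"
proof
  fix f g h :: "'a skeleton_arrow"
  assume f: "f \<in> skeleton_arrows"
  note f_map = skeleton_arrow_map[OF f]
  show "arrow_src f \<in> skeletons" "arrow_tgt f \<in> skeletons"
    using f by (simp_all add: skeleton_arrows_def)
  show "skeleton_comp f (skeleton_id (arrow_src f)) = f"
    by (simp add: skeleton_comp_def skeleton_id_def id_def compose_Id[OF f_map])
  show "skeleton_comp (skeleton_id (arrow_tgt f)) f = f"
    by (simp add: skeleton_comp_def skeleton_id_def id_def Id_compose[OF f_map])
  assume g: "g \<in> skeleton_arrows" and fg: "arrow_tgt f = arrow_src g"
  show "skeleton_comp g f \<in> skeleton_arrows"
    using f g fg skeleton_morphism_compose[OF dual_in_points]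
    by (auto simp: skeleton_arrows_def skeleton_comp_def)
  show "arrow_src (skeleton_comp g f) = arrow_src f"
    "arrow_tgt (skeleton_comp g f) = arrow_tgt g"
    by (simp_all add: skeleton_comp_def)
  show "skeleton_comp h (skeleton_comp g f) = skeleton_comp (skeleton_comp h g) f"
    using fg by (simp add: skeleton_comp_def compose_assoc[OF f_map(1)])
next
  fix E :: "'a skeleton"
  assume "E \<in> skeletons"
  then show "skeleton_id E \<in> skeleton_arrows"
    by (simp add: skeleton_arrows_def skeleton_id_def skeleton_morphism_id dual_in_points)
  show "arrow_src (skeleton_id E) = E" "arrow_tgt (skeleton_id E) = E"
    by (simp_all add: skeleton_id_def)
qed

text \<open>
  Truncating to the points of the source leaves the values there unchanged, which is why the
  composition and the identities of this category are the ordinary ones.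
\<close>

theorem proposition5p3:
  shows "category (skeletons :: 'a skeleton set) skeleton_arrows arrow_src arrow_tgt
           skeleton_id skeleton_comp \<and>
         (\<forall>f\<in>(skeleton_arrows :: 'a skeleton_arrow set). \<forall>g\<in>skeleton_arrows.
            arrow_tgt f = arrow_src g \<longrightarrow>
            (\<forall>z\<in>points (arrow_src f).
               arrow_map (skeleton_comp g f) z = (arrow_map g \<circ> arrow_map f) z)) \<and>
         (\<forall>E\<in>(skeletons :: 'a skeleton set). \<forall>z\<in>points E.
            arrow_map (skeleton_id E) z = id z)"
  using skeletons_category by (auto simp: skeleton_comp_def skeleton_id_def compose_eq)

end
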